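(* Let $G$ be a finite group with identity element $e$, such that $|G|>1$ is not a prime number. Let $\Gamma=(\Gamma_0,\Gamma_1,\mu,\mathfrak{o})$ be the configuration defined by: (1) $\Gamma_0=G$; (2) $\Gamma_1=\{H\mid H\leqslant G\text{ and }H\neq\{e\}\}$; (3) $\mu:G\to\mathbb{Z}_{>0}$ is a function such that $\mu(e)=1$; (4) $\mathfrak{o}$ is a chosen fixed orientation over the objects in $\Gamma_1$. Then $\Gamma$ is a Brauer configuration.
   Context: $H\leqslant G$ means that $H$ is a subgroup of $G$; a set is regarded as a multiset in which each element occurs once. A Brauer configuration is a quadruple $\Gamma=(\Gamma_0,\Gamma_1,\mu,\mathfrak{o})$ where: $\Gamma_0$ is a finite set (vertices); $\Gamma_1$ is a finite collection of finite labeled multisets of elements of $\Gamma_0$ (polygons); $\mu:\Gamma_0\to\mathbb{Z}_{>0}$ is a function (multiplicity). For $\alpha\in\Gamma_0$, $V\in\Gamma_1$, $\mathrm{occ}(\alpha,V)$ is the number of times $\alpha$ occurs in $V$, and $\mathrm{val}(\alpha)=\sum_{V\in\Gamma_1}\mathrm{occ}(\alpha,V)$. A vertex $\alpha$ is truncated if $\mathrm{val}(\alpha)=\mu(\alpha)=1$. The orientation $\mathfrak{o}$ is a choice, for each nontruncated vertex $\alpha$, of a cyclic ordering of the list of polygons containing $\alpha$, in which each $V$ appears $\mathrm{occ}(\alpha,V)$ times. It is required that: (C1) every vertex occurs in at least one polygon; (C2) every polygon has at least two vertices (counted with repetition); (C3) every polygon contains a vertex $\alpha$ with $\mathrm{val}(\alpha)\mu(\alpha)>1$.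 *)

theory Defs
  imports "HOL-Algebra.Coset" "HOL-Library.Multiset" "HOL-Computational_Algebra.Primes"
begin

(* Labelled polygons: bc_polygons is the set of labels of the polygons, and bc_mset V is the
   multiset of vertices of the polygon labelled V.  Different labels may carry equal multisets.
   A polygon is referred to by its label throughout. *)
record ('a, 'l) brauer_data =
  bc_vertices :: "'a set"
  bc_polygons :: "'l set"
  bc_mset :: "'l \<Rightarrow> 'a multiset"
  bc_mult :: "'a \<Rightarrow> nat"
  bc_orient :: "'a \<Rightarrow> 'l list set"

definition occ :: "('a, 'l) brauer_data \<Rightarrow> 'a \<Rightarrow> 'l \<Rightarrow> nat" where
  "occ \<Gamma> \<alpha> V = count (bc_mset \<Gamma> V) \<alpha>"

definition val :: "('a, 'l) brauer_data \<Rightarrow> 'a \<Rightarrow> nat" where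
  "val \<Gamma> \<alpha> = (\<Sum>V\<in>bc_polygons \<Gamma>. occ \<Gamma> \<alpha> V)"

definition truncated :: "('a, 'l) brauer_data \<Rightarrow> 'a \<Rightarrow> bool" where
  "truncated \<Gamma> \<alpha> \<longleftrightarrow> val \<Gamma> \<alpha> = 1 \<and> bc_mult \<Gamma> \<alpha> = 1"

definition polygons_at :: "('a, 'l) brauer_data \<Rightarrow> 'a \<Rightarrow> 'l multiset" where
  "polygons_at \<Gamma> \<alpha> = (\<Sum>V\<in>bc_polygons \<Gamma>. replicate_mset (occ \<Gamma> \<alpha> V) V)"

(* A cyclic ordering of a multiset is a list of its elements up to rotation, that is,
   the set of all rotations of such a list. *)
definition cyclic_ordering :: "'l multiset \<Rightarrow> 'l list set \<Rightarrow> bool" where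
  "cyclic_ordering M C \<longleftrightarrow> (\<exists>xs. mset xs = M \<and> C = {rotate n xs | n. True})"

(* The value of bc_orient at truncated vertices and outside bc_vertices is irrelevant. *)
definition is_orientation :: "('a, 'l) brauer_data \<Rightarrow> bool" where
  "is_orientation \<Gamma> \<longleftrightarrow>
     (\<forall>\<alpha>\<in>bc_vertices \<Gamma>. \<not> truncated \<Gamma> \<alpha> \<longrightarrow>
        cyclic_ordering (polygons_at \<Gamma> \<alpha>) (bc_orient \<Gamma> \<alpha>))"

definition brauer_configuration :: "('a, 'l) brauer_data \<Rightarrow> bool" where
  "brauer_configuration \<Gamma> \<longleftrightarrow>
     finite (bc_vertices \<Gamma>) \<and>
     finite (bc_polygons \<Gamma>) \<and>
     (\<forall>V\<in>bc_polygons \<Gamma>. set_mset (bc_mset \<Gamma> V) \<subseteq> bc_vertices \<Gamma>) \<and>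
     (\<forall>\<alpha>\<in>bc_vertices \<Gamma>. bc_mult \<Gamma> \<alpha> > 0) \<and>
     is_orientation \<Gamma> \<and>
     (\<forall>\<alpha>\<in>bc_vertices \<Gamma>. \<exists>V\<in>bc_polygons \<Gamma>. \<alpha> \<in># bc_mset \<Gamma> V) \<and>
     (\<forall>V\<in>bc_polygons \<Gamma>. size (bc_mset \<Gamma> V) \<ge> 2) \<and>
     (\<forall>V\<in>bc_polygons \<Gamma>. \<exists>\<alpha>\<in>#bc_mset \<Gamma> V. val \<Gamma> \<alpha> * bc_mult \<Gamma> \<alpha> > 1)"

end

theory Submission
  imports Defs "HOL-Algebra.Sylow"
begin

text \<open>Only (C3) uses that the order is composite. The identity lies in every polygon, so its
  valency is the number of nontrivial subgroups. A subgroup of prime order, which exists by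
  Sylow's theorem, is then proper, and with the whole group it makes this valency at least 2.\<close>

lemma (in group) exists_proper_nontrivial_subgroup:
  assumes "finite (carrier G)" "order G > 1" "\<not> prime (order G)"
  obtains H where "subgroup H G" "H \<noteq> {\<one>}" "H \<noteq> carrier G"
proof -
  obtain p m where p: "prime p" "order G = p * m"
    using prime_factor_nat[of "order G"] assms(2) by (auto elim: dvdE)
  \<comment> \<open>With exponent 1, where \<open>p\<close> may still divide \<open>m\<close>,
    Sylow's theorem becomes Cauchy's theorem: \<open>H\<close> has order exactly \<open>p\<close>.
    It is therefore nontrivial, and it differs from the whole group because the order of the latter
    is not prime.\<close>
  then obtain H where H: "subgroup H G" "card H = p ^ 1"
    using sylow_thm[of p G 1 m] is_group assms(1) by auto
  have "H \<noteq> {\<one>}"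
    using H p(1) prime_gt_1_nat by force
  moreover have "H \<noteq> carrier G"
    using H p(1) assms(3) by (auto simp: order_def)
  ultimately show thesis
    using H(1) that by blast
qed

lemma (in group) finite_subgroups: "finite (carrier G) \<Longrightarrow> finite {H. subgroup H G \<and> P H}"
  by (rule finite_subset[of _ "Pow (carrier G)"]) (auto dest: subgroup.subset)

theorem proposition5p4:
  fixes G :: "('a, 'b) monoid_scheme"
    and \<mu> :: "'a \<Rightarrow> nat"
    and ori :: "'a \<Rightarrow> 'a set list set"
    and \<Gamma> :: "('a, 'a set) brauer_data"
  assumes "group G"
    and "finite (carrier G)"
    and "order G > 1"
    and "\<not> prime (order G)"
    and "\<Gamma> = \<lparr> bc_vertices = carrier G,
                bc_polygons = {H. subgroup H G \<and> H \<noteq> {\<one>\<^bsub>G\<^esub>}},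
                bc_mset = mset_set,
                bc_mult = \<mu>,
                bc_orient = ori \<rparr>"
    and "\<forall>g\<in>carrier G. \<mu> g > 0"
    and "\<mu> \<one>\<^bsub>G\<^esub> = 1"
    and "is_orientation \<Gamma>"
  shows "brauer_configuration \<Gamma>"
proof -
  interpret group G by fact
  define S where "S = {H. subgroup H G \<and> H \<noteq> {\<one>\<^bsub>G\<^esub>}}"
  have fin_S: "finite S"
    unfolding S_def using assms(2) by (rule finite_subgroups)
  \<comment> \<open>Finiteness of \<open>H\<close> matters because \<open>mset_set\<close> sends an
    infinite set to the empty multiset.\<close>
  have sub: "H \<subseteq> carrier G" "finite H" "\<one>\<^bsub>G\<^esub> \<in> H" if "H \<in> S" for H
    using that assms(2) finite_subset
    by (auto simp: S_def dest: subgroup.subset subgroup.one_closed)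
  have "carrier G \<noteq> {\<one>\<^bsub>G\<^esub>}"
    using assms(3) by (auto simp: order_def)
  then have carrier_S: "carrier G \<in> S"
    by (simp add: S_def subgroup_self)
  obtain K where K: "K \<in> S" "K \<noteq> carrier G"
    using exists_proper_nontrivial_subgroup[OF assms(2-4)] by (auto simp: S_def)
  \<comment> \<open>The identity occurs exactly once in each polygon, so every summand of the
    valency is 1.\<close>
  have "val \<Gamma> \<one>\<^bsub>G\<^esub> = card S"
    using sub by (simp add: val_def occ_def assms(5) S_def[symmetric])
  moreover have "card S \<ge> card {K, carrier G}"
    using K carrier_S fin_S by (intro card_mono) auto
  ultimately have val_one: "val \<Gamma> \<one>\<^bsub>G\<^esub> > 1"
    using K by simp
  have card_ge_2: "card H \<ge> 2" if "H \<in> S" for H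
  proof -
    \<comment> \<open>A nontrivial subgroup strictly contains the trivial one, which gives
      (C2).\<close>
    have "card {\<one>\<^bsub>G\<^esub>} < card H"
      using sub[OF that] that by (intro psubset_card_mono) (auto simp: S_def)
    then show ?thesis by simp
  qed
  have "bc_vertices \<Gamma> = carrier G" "bc_polygons \<Gamma> = S" "bc_mset \<Gamma> = mset_set" "bc_mult \<Gamma> = \<mu>"
    by (simp_all add: assms(5) S_def)
  then show ?thesis
    unfolding brauer_configuration_def
    using assms(2,6-8) fin_S sub carrier_S card_ge_2 val_one
    \<comment> \<open>The whole group is a polygon through every vertex, as (C1) asks. The identity
      is the witness for (C3): its multiplicity is 1, so the product there is just its
      valency.\<close>
    by (auto intro!: bexI[of _ "carrier G"] bexI[of _ "\<one>\<^bsub>G\<^esub>"])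
qed

end
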